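(* For all positive integers $a,n$, $$\nu_5 \left( {5^a n \choose n}_F \right) = \nu_5 \left( {5^a n \choose n} \right) = \frac{s_5 ((5^a - 1)n)}{4}.$$ In particular, ${5^an \choose n}_F$ is divisible by $5$ for all positive integers $a,n$.
   Context: The Fibonacci sequence is $F_1=F_2=1$, $F_n=F_{n-1}+F_{n-2}$ for $n\ge 3$. For $m\ge 1$ and $1\le k\le m$ the Fibonomial coefficient is ${m \choose k}_F = \frac{F_1F_2\cdots F_m}{(F_1\cdots F_k)(F_1\cdots F_{m-k})}$ (an integer). $\nu_5(x)$ is the exponent of $5$ in $x$, ${m\choose k}$ is the ordinary binomial coefficient, and $s_5(n)$ is the sum of the base-$5$ digits of $n$. *)

theory Defs
  imports "HOL-Number_Theory.Number_Theory"
begin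

definition fibonorial :: "nat \<Rightarrow> nat" where
  "fibonorial m = (\<Prod>i=1..m. fib i)"

text \<open>
  The division is exact for \<open>k \<le> m\<close>; see \<open>of_nat_fibonomial\<close> below.
\<close>

definition fibonomial :: "nat \<Rightarrow> nat \<Rightarrow> nat" where
  "fibonomial m k = fibonorial m div (fibonorial k * fibonorial (m - k))"

lemma fibonorial_0 [simp]: "fibonorial 0 = 1"
  by (simp add: fibonorial_def)

lemma fibonorial_Suc: "fibonorial (Suc m) = fib (Suc m) * fibonorial m"
  by (simp add: fibonorial_def prod.nat_ivl_Suc' mult.commute)

lemma fibonorial_pos: "fibonorial m > 0"
  by (auto simp: fibonorial_def intro!: prod_pos fib_neq_0_nat)

lemma fibonorial_mult_dvd: "fibonorial k * fibonorial j dvd fibonorial (k + j)"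
proof (induction "k + j" arbitrary: k j)
  case 0
  then show ?case by simp
next
  case (Suc N)
  show ?case
  proof (cases "k = 0 \<or> j = 0")
    case True
    then show ?thesis by auto
  next
    case False
    then obtain k' j' where kj: "k = Suc k'" "j = Suc j'"
      by (metis not0_implies_Suc)
    have N: "N = k' + j" "N = k + j'" using Suc.hyps(2) kj by auto
    have 1: "fibonorial k' * fibonorial j dvd fibonorial N"
      using Suc.hyps(1)[OF N(1)] N(1) by simp
    have 2: "fibonorial k * fibonorial j' dvd fibonorial N"
      using Suc.hyps(1)[OF N(2)] N(2) by simp
    have "fib (Suc N) = fib (Suc (k' + j))" using N by simp
    also have "\<dots> = fib (Suc j) * fib k + fib j * fib k'"
      using fib_add[of k' j] kj by simp
    finally have f: "fibonorial (k + j) =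
        fib (Suc j) * (fib k * fibonorial N) + fib k' * (fib j * fibonorial N)"
      using Suc.hyps(2)[symmetric] by (simp add: fibonorial_Suc algebra_simps)
    have "fibonorial k * fibonorial j dvd fib k * fibonorial N"
      using mult_dvd_mono[OF dvd_refl[of "fib k"] 1] kj
      by (simp add: fibonorial_Suc mult.assoc del: fib.simps)
    moreover have "fibonorial k * fibonorial j dvd fib j * fibonorial N"
      using mult_dvd_mono[OF dvd_refl[of "fib j"] 2] kj
      by (simp add: fibonorial_Suc mult_ac del: fib.simps)
    ultimately show ?thesis
      unfolding f by (metis dvd_add dvd_mult)
  qed
qed

lemma of_nat_fibonomial:
  assumes "k \<le> m"
  shows "(of_nat (fibonomial m k) :: 'a :: field_char_0) =
    of_nat (fibonorial m) / (of_nat (fibonorial k) * of_nat (fibonorial (m - k)))"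
proof -
  let ?d = "fibonorial k * fibonorial (m - k)"
  have "fibonomial m k * ?d = fibonorial m"
    using fibonorial_mult_dvd[of k "m - k"] assms by (simp add: fibonomial_def)
  then have "(of_nat (fibonomial m k) :: 'a) * of_nat ?d = of_nat (fibonorial m)"
    by (metis of_nat_mult)
  moreover have "(of_nat ?d :: 'a) \<noteq> 0"
    using fibonorial_pos[of k] fibonorial_pos[of "m - k"] by simp
  ultimately show ?thesis
    by (simp add: eq_divide_eq)
qed

fun digit_sum5 :: "nat \<Rightarrow> nat" where
  "digit_sum5 n = (if n = 0 then 0 else n mod 5 + digit_sum5 (n div 5))"

declare digit_sum5.simps [simp del]

end

theory Submission
  imports Defs
begin

text \<open>
  Writing \<open>L n\<close> for the Lucas numbers, the recurrence
  \<open>F (m + 2n) = L n * F (m + n) - (-1)^n * F m\<close> and \<open>(L n)^2 = 5 (F n)^2 + 4 (-1)^n\<close> give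
  \<open>F (5n) = 5 F n * (5 (F n)^4 + 5 (-1)^n (F n)^2 + 1)\<close>. So passing from \<open>n\<close> to \<open>5n\<close> adds exactly
  one factor 5 to \<open>F n\<close>, and since 5 divides \<open>F n\<close> only if it divides \<open>n\<close>, the numbers \<open>F n\<close> and \<open>n\<close>
  have the same 5-adic valuation. Hence so do fibonorials and factorials, and Fibonomial and
  binomial coefficients. For a prime \<open>p\<close>, Legendre's formula \<open>(p - 1) v(n!) = n - s(n)\<close> turns the
  valuation of a binomial coefficient into digit sums, two of which cancel because
  \<open>s(p^a n) = s(n)\<close>.
\<close>

section \<open>Divisibility of Fibonacci numbers\<close>

definition lucas :: "nat \<Rightarrow> int" where
  "lucas n = 2 * int (fib (Suc n)) - int (fib n)"

lemma fib_Cassini_int_Suc: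
  "int (fib (Suc n)) ^ 2 - int (fib n) * int (fib (Suc n)) - int (fib n) ^ 2 = (-1) ^ n"
  using fib_Cassini_int[of n] by (simp add: power2_eq_square algebra_simps)

lemma lucas_square: "lucas n ^ 2 = 5 * int (fib n) ^ 2 + 4 * (-1) ^ n"
  unfolding lucas_def fib_Cassini_int_Suc[of n, symmetric]
  by (simp add: power2_eq_square algebra_simps)

lemma int_fib_double: "int (fib (2 * n)) = lucas n * int (fib n)"
  unfolding fib_rec_even lucas_def by (cases n) (simp_all add: algebra_simps)

lemma int_fib_add_double:
  "int (fib (m + 2 * n)) = lucas n * int (fib (m + n)) - (-1) ^ n * int (fib m)"
proof (induction m rule: fib.induct)
  case 1
  show ?case
    by (simp add: int_fib_double)
next
  case 2
  have "int (fib (Suc (2 * n))) = int (fib n) ^ 2 + int (fib (Suc n)) ^ 2"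
    by (simp add: fib_rec_odd)
  also have "\<dots> = lucas n * int (fib (Suc n)) - (-1) ^ n"
    unfolding lucas_def fib_Cassini_int_Suc[of n, symmetric]
    by (simp add: power2_eq_square algebra_simps)
  finally show ?case
    by simp
next
  case (3 m)
  then show ?case
    by (simp add: algebra_simps)
qed

lemma int_fib_5_mult:
  "int (fib (5 * n)) = 5 * int (fib n) * (5 * (int (fib n) ^ 4 + (-1) ^ n * int (fib n) ^ 2) + 1)"
proof -
  define x l e where "x = int (fib n)" and "l = lucas n" and "e = (-1 :: int) ^ n"
  have e_square: "e ^ 2 = 1"
    by (simp add: e_def flip: power_mult)
  have l_square: "l ^ 2 = 5 * x ^ 2 + 4 * e"
    by (simp add: l_def x_def e_def lucas_square)
  have fib_rec_mult:
    "int (fib ((k + 2) * n)) = l * int (fib ((k + 1) * n)) - e * int (fib (k * n))" for k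
    unfolding l_def e_def add_mult_distrib mult_1 by (rule int_fib_add_double)
  have fib_2: "int (fib (2 * n)) = l * x"
    by (simp add: int_fib_double l_def x_def)
  have fib_3: "int (fib (3 * n)) = l * (l * x) - e * x"
    using fib_rec_mult[of 1] by (simp add: fib_2 x_def del: One_nat_def)
  have fib_4: "int (fib (4 * n)) = l * (l * (l * x) - e * x) - e * (l * x)"
    using fib_rec_mult[of 2] by (simp add: fib_2 fib_3)
  have "int (fib (5 * n)) =
      l * (l * (l * (l * x) - e * x) - e * (l * x)) - e * (l * (l * x) - e * x)"
    using fib_rec_mult[of 3] by (simp add: fib_3 fib_4)
  also have "\<dots> = ((l ^ 2) ^ 2 - 3 * e * l ^ 2 + e ^ 2) * x"
    by (simp add: power2_eq_square algebra_simps)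
  also have "\<dots> = 5 * x * (5 * (x ^ 4 + e * x ^ 2) + e ^ 2)"
    unfolding l_square by (simp add: power2_eq_square power4_eq_xxxx algebra_simps)
  finally show ?thesis
    unfolding e_square unfolding x_def e_def .
qed

lemma fib_dvd_fib_iff:
  assumes "m > 2"
  shows "fib m dvd fib n \<longleftrightarrow> m dvd n"
proof
  assume "fib m dvd fib n"
  then have fib_gcd_eq: "fib (gcd m n) = fib m"
    by (simp add: fib_gcd gcd_nat.absorb1)
  obtain k where m: "m = Suc (Suc (Suc k))"
    using less_imp_Suc_add[OF assms] by auto
  have "\<not> gcd m n \<le> Suc (Suc k)"
  proof
    assume "gcd m n \<le> Suc (Suc k)"
    then have "fib (gcd m n) \<le> fib (Suc (Suc k))"
      by (rule fib_mono)
    also have "\<dots> < fib (Suc (Suc k)) + fib (Suc k)"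
      by (simp add: fib_neq_0_nat)
    also have "\<dots> = fib m"
      by (simp add: m)
    finally show False
      using fib_gcd_eq by simp
  qed
  moreover have "gcd m n \<le> m"
    using assms by (intro gcd_le1_nat) simp
  ultimately have "gcd m n = m"
    unfolding m by linarith
  then show "m dvd n"
    by (metis gcd_dvd2)
next
  assume "m dvd n"
  then show "fib m dvd fib n"
    by (metis fib_gcd gcd_dvd2 gcd_nat.absorb1)
qed

lemma five_dvd_fib_iff: "5 dvd fib n \<longleftrightarrow> 5 dvd n"
proof -
  have "fib 5 = 5"
    by (simp add: numeral_eq_Suc)
  then show ?thesis
    using fib_dvd_fib_iff[of 5 n] by simp
qed


section \<open>The 5-adic valuation of Fibonacci numbers and Fibonomial coefficients\<close>

lemma multiplicity_int_int_eq: "multiplicity (int p) (int n) = multiplicity p n"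
  by (simp add: multiplicity_def flip: of_nat_power)

lemma multiplicity_5_fib_5_mult:
  assumes "n > 0"
  shows "multiplicity 5 (fib (5 * n)) = Suc (multiplicity 5 (fib n))"
proof -
  define x where "x = int (fib n)"
  define q where "q = 5 * (x ^ 4 + (-1) ^ n * x ^ 2) + 1"
  have not_dvd: "\<not> 5 dvd q"
    unfolding q_def by presburger
  then have "q * x \<noteq> 0"
    using assms by (auto simp: x_def fib_neq_0_nat)
  have "multiplicity 5 (int (fib (5 * n))) = multiplicity 5 (5 * (q * x))"
    unfolding int_fib_5_mult x_def q_def by (simp only: ac_simps)
  also have "\<dots> = Suc (multiplicity 5 (q * x))"
    using \<open>q * x \<noteq> 0\<close> by (intro multiplicity_times_same) simp_all
  also have "multiplicity 5 (q * x) = multiplicity 5 x"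
    using not_dvd by (intro multiplicity_prime_elem_times_other) simp_all
  finally show ?thesis
    using multiplicity_int_int_eq[of 5] by (simp add: x_def)
qed

lemma multiplicity_5_fib: "multiplicity 5 (fib n) = multiplicity 5 n"
proof (induction n rule: less_induct)
  case (less n)
  show ?case
  proof (cases "5 dvd n \<and> n > 0")
    case True
    then obtain k where n: "n = 5 * k" and "k > 0"
      by auto
    then have "multiplicity 5 (fib n) = Suc (multiplicity 5 k)"
      by (simp add: multiplicity_5_fib_5_mult less.IH)
    also have "\<dots> = multiplicity 5 n"
      using \<open>k > 0\<close> by (simp add: n multiplicity_times_same)
    finally show ?thesis .
  next
    case False
    then show ?thesis
      by (auto simp: five_dvd_fib_iff not_dvd_imp_multiplicity_0)
  qed
qed

lemma multiplicity_5_fibonorial: "multiplicity 5 (fibonorial n) = multiplicity 5 (fact n :: nat)"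
proof -
  have "multiplicity 5 (fibonorial n) = (\<Sum>i=1..n. multiplicity 5 (fib i))"
    unfolding fibonorial_def
    by (rule prime_elem_multiplicity_prod_distrib)
      (simp_all add: image_iff Suc_le_eq fib_neq_0_nat)
  also have "\<dots> = (\<Sum>i=1..n. multiplicity 5 i)"
    by (simp add: multiplicity_5_fib)
  also have "\<dots> = multiplicity 5 (fact n :: nat)"
    unfolding fact_prod of_nat_id
    by (rule prime_elem_multiplicity_prod_distrib[symmetric]) auto
  finally show ?thesis .
qed

lemma multiplicity_choose:
  fixes p :: nat
  assumes "prime p" and "k \<le> m"
  shows "multiplicity p (m choose k) + multiplicity p (fact k :: nat)
      + multiplicity p (fact (m - k) :: nat) = multiplicity p (fact m :: nat)"
proof -
  have "fact m = (m choose k) * (fact k * fact (m - k))"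
    using binomial_fact_lemma[OF \<open>k \<le> m\<close>] by (simp add: ac_simps)
  then show ?thesis
    using assms by (simp add: prime_elem_multiplicity_mult_distrib)
qed

lemma fibonomial_mult_fibonorial:
  assumes "k \<le> m"
  shows "fibonomial m k * (fibonorial k * fibonorial (m - k)) = fibonorial m"
  using fibonorial_mult_dvd[of k "m - k"] assms by (simp add: fibonomial_def)

lemma fibonomial_pos:
  assumes "k \<le> m"
  shows "fibonomial m k > 0"
  using fibonomial_mult_fibonorial[OF assms] fibonorial_pos[of m] by (auto intro: gr0I)

lemma multiplicity_fibonomial:
  fixes p :: nat
  assumes "prime p" and "k \<le> m"
  shows "multiplicity p (fibonomial m k) + multiplicity p (fibonorial k)
      + multiplicity p (fibonorial (m - k)) = multiplicity p (fibonorial m)"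
  using assms fibonomial_pos[OF \<open>k \<le> m\<close>] fibonorial_pos[of k] fibonorial_pos[of "m - k"]
  by (simp add: prime_elem_multiplicity_mult_distrib flip: fibonomial_mult_fibonorial[OF \<open>k \<le> m\<close>])

lemma multiplicity_5_fibonomial:
  assumes "k \<le> m"
  shows "multiplicity 5 (fibonomial m k) = multiplicity 5 (m choose k)"
  using multiplicity_choose[of 5, OF _ assms] multiplicity_fibonomial[of 5, OF _ assms]
  by (simp add: multiplicity_5_fibonorial)


section \<open>Digit sums and Legendre's formula\<close>

fun digit_sum :: "nat \<Rightarrow> nat \<Rightarrow> nat" where
  "digit_sum b n = (if n = 0 \<or> b \<le> 1 then 0 else n mod b + digit_sum b (n div b))"

declare digit_sum.simps [simp del]

lemma digit_sum5_eq_digit_sum: "digit_sum5 n = digit_sum 5 n"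
proof (induction n rule: digit_sum5.induct)
  case (1 n)
  then show ?case
    by (simp add: digit_sum5.simps[of n] digit_sum.simps[of 5 n])
qed

lemma digit_sum_0 [simp]: "digit_sum b 0 = 0"
  by (simp add: digit_sum.simps)

lemma digit_sum_mult_add:
  assumes "r < b"
  shows "digit_sum b (b * n + r) = r + digit_sum b n"
  using assms by (cases "b = 1") (auto simp: digit_sum.simps[of b "b * n + r"])

lemma digit_sum_mult: "b > 0 \<Longrightarrow> digit_sum b (b * n) = digit_sum b n"
  using digit_sum_mult_add[of 0 b n] by simp

lemma digit_sum_power_mult: "b > 0 \<Longrightarrow> digit_sum b (b ^ a * n) = digit_sum b n"
  by (induction a) (simp_all add: digit_sum_mult mult.assoc)

lemma digit_sum_eq_0_iff:
  assumes "b > 1"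
  shows "digit_sum b n = 0 \<longleftrightarrow> n = 0"
proof (induction n rule: less_induct)
  case (less n)
  show ?case
  proof (cases "n = 0")
    case False
    then have "digit_sum b n = 0 \<longleftrightarrow> n mod b = 0 \<and> n div b = 0"
      using assms less.IH[of "n div b"] by (simp add: digit_sum.simps[of b n])
    also have "\<dots> \<longleftrightarrow> n = 0"
      by (metis div_mult_mod_eq add_0 mult_0 div_0 mod_0)
    finally show ?thesis .
  qed simp
qed

text \<open>Each factor \<open>b\<close> of \<open>Suc n\<close> is a trailing digit \<open>b - 1\<close> of \<open>n\<close> turned into 0.\<close>

lemma digit_sum_Suc:
  assumes "b > 1"
  shows "(b - 1) * multiplicity b (Suc n) + digit_sum b (Suc n) = Suc (digit_sum b n)"
proof (induction n rule: less_induct)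
  case (less n)
  define k r where "k = n div b" and "r = n mod b"
  have n: "n = b * k + r" and "r < b"
    using assms by (simp_all add: k_def r_def)
  have sum_n: "digit_sum b n = r + digit_sum b k"
    using \<open>r < b\<close> by (simp add: n digit_sum_mult_add)
  consider (carry) "Suc r = b" | (no_carry) "Suc r < b"
    using \<open>r < b\<close> by linarith
  then show ?case
  proof cases
    case carry
    then have "Suc n = b * Suc k"
      by (simp add: n)
    moreover have "multiplicity b (b * Suc k) = Suc (multiplicity b (Suc k))"
      using assms by (intro multiplicity_times_same) simp_all
    moreover have "digit_sum b (b * Suc k) = digit_sum b (Suc k)"
      using assms by (intro digit_sum_mult) simp
    moreover have "k \<le> b * k"
      using assms by simp
    then have "k < n"
      using carry assms n by linarith
    ultimately show ?thesis
      using less.IH[of k] carry sum_n by simp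
  next
    case no_carry
    have Suc_n: "Suc n = b * k + Suc r"
      by (simp add: n)
    then have "\<not> b dvd Suc n"
      using no_carry by (simp add: dvd_eq_mod_eq_0 del: add_Suc_right)
    then show ?thesis
      unfolding Suc_n using digit_sum_mult_add[OF no_carry, of k] sum_n
      by (simp add: not_dvd_imp_multiplicity_0 del: add_Suc_right)
  qed
qed

lemma legendre_formula:
  assumes "prime p"
  shows "(p - 1) * multiplicity p (fact n :: nat) + digit_sum p n = n"
proof (induction n)
  case (Suc n)
  have "multiplicity p (fact (Suc n) :: nat) = multiplicity p (Suc n * fact n)"
    by simp
  also have "\<dots> = multiplicity p (Suc n) + multiplicity p (fact n :: nat)"
    using assms by (intro prime_elem_multiplicity_mult_distrib) auto
  finally show ?case
    using Suc digit_sum_Suc[OF prime_gt_1_nat[OF assms], of n] by (simp add: add_mult_distrib2)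
qed simp

lemma legendre_formula_choose:
  assumes "prime p" and "k \<le> m"
  shows "(p - 1) * multiplicity p (m choose k) + digit_sum p m
    = digit_sum p k + digit_sum p (m - k)"
proof -
  define v where "v j = (p - 1) * multiplicity p (fact j :: nat)" for j
  have "(p - 1) * multiplicity p (m choose k) + v k + v (m - k) = v m"
    by (simp add: v_def flip: multiplicity_choose[OF assms] add_mult_distrib2)
  moreover have "v j + digit_sum p j = j" for j
    unfolding v_def by (rule legendre_formula) fact
  from this[of k] this[of "m - k"] this[of m] have
    "v k + digit_sum p k + (v (m - k) + digit_sum p (m - k)) = v m + digit_sum p m"
    using \<open>k \<le> m\<close> by simp
  ultimately show ?thesis
    by simp
qed

lemma multiplicity_power_mult_choose:
  assumes "prime p"
  shows "(p - 1) * multiplicity p (p ^ a * n choose n) = digit_sum p ((p ^ a - 1) * n)"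
proof -
  have "p > 0"
    using assms by (rule prime_gt_0_nat)
  then have "n \<le> p ^ a * n"
    by simp
  from legendre_formula_choose[OF assms this] show ?thesis
    using \<open>p > 0\<close> by (simp add: digit_sum_power_mult diff_mult_distrib)
qed

theorem theorem11:
  fixes a n :: nat
  assumes "a > 0" and "n > 0"
  shows "multiplicity 5 (fibonomial (5 ^ a * n) n) = multiplicity 5 ((5 ^ a * n) choose n)
    \<and> real (multiplicity 5 ((5 ^ a * n) choose n)) = real (digit_sum5 ((5 ^ a - 1) * n)) / 4
    \<and> 5 dvd fibonomial (5 ^ a * n) n"
proof -
  have fibonomial_eq:
    "multiplicity 5 (fibonomial (5 ^ a * n) n) = multiplicity 5 ((5 ^ a * n) choose n)"
    by (rule multiplicity_5_fibonomial) simp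
  have choose_eq:
    "4 * multiplicity 5 ((5 ^ a * n) choose n) = digit_sum5 ((5 ^ a - 1) * n)"
    using multiplicity_power_mult_choose[of 5 a n] by (simp add: digit_sum5_eq_digit_sum)
  have "digit_sum 5 ((5 ^ a - 1) * n) \<noteq> 0"
    using assms one_less_power[of "5 :: nat" a] by (simp add: digit_sum_eq_0_iff)
  then have "multiplicity 5 (fibonomial (5 ^ a * n) n) > 0"
    using fibonomial_eq choose_eq by (simp add: digit_sum5_eq_digit_sum)
  then have "5 dvd fibonomial (5 ^ a * n) n"
    using not_dvd_imp_multiplicity_0 by fastforce
  moreover have
    "real (multiplicity 5 ((5 ^ a * n) choose n)) = real (digit_sum5 ((5 ^ a - 1) * n)) / 4"
    using choose_eq by linarith
  ultimately show ?thesis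
    using fibonomial_eq by blast
qed

end
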